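(* Let $0<r<1$ and let $Z$ be a nonnegative integer-valued random variable with probability generating function $Q(w)=\mathbb{E}[w^{Z}]$. Then $Z$ has finite $r$-th absolute moment, $\mathbb{E}Z^r<\infty$, if and only if $$\int_{0}^{1}\frac{1-Q(w)}{(-\log w)^{1+r}\,w}\,dw<\infty .$$ *)

theory Defs
  imports "HOL-Probability.Probability"
begin

text \<open>
  The expectation is a Bochner integral, which is 0 by convention for a non-integrable
  function. For \<open>\<bar>w\<bar> \<le> 1\<close> the function \<open>w ^ Z\<close> is bounded, hence integrable on a
  probability space, so there \<open>pgf M Z w\<close> is the true value.
\<close>

definition pgf :: "'a measure \<Rightarrow> ('a \<Rightarrow> nat) \<Rightarrow> real \<Rightarrow> real" where
  "pgf M Z w = (\<integral>x. w ^ Z x \<partial>M)"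

end

theory Submission
  imports Defs "HOL-Real_Asymp.Real_Asymp"
begin

text \<open>
  The equivalence follows from an exact identity: the integral of the theorem equals
  \<open>C * E[Z powr r]\<close>, where \<open>0 < C < \<infinity>\<close> depends on \<open>r\<close> only.

  Write \<open>1 - Q(w) = E[1 - w ^ Z]\<close>. Everything is nonnegative, so Tonelli's theorem
  (\<open>nn_integral_pgf_kernel\<close>) turns the integral into the expectation of
  \<open>I(Z)\<close>, where \<open>I(n)\<close> is the integral of \<open>1 - w ^ n\<close> against the kernel
  \<open>1 / ((- ln w) powr (1 + r) * w)\<close>. This kernel is homogeneous under \<open>u = w ^ n\<close>: the measure
  \<open>dw / w\<close> and the function \<open>- ln w\<close> are both multiplied by \<open>n\<close>. Hence \<open>I(n) = n powr r * I(1)\<close>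
  (\<open>nn_integral_one_minus_power_log_kernel\<close>), and \<open>C = I(1)\<close>.

  The constant is positive because its integrand is positive on the whole interval. It is
  finite (\<open>moment_const_finite\<close>) because the condition \<open>0 < r\<close> makes the kernel integrable at 0,
  and because \<open>1 - w \<le> - ln w\<close> lowers the exponent at 1 from \<open>1 + r\<close> to \<open>r < 1\<close>.
\<close>

definition log_kernel :: "real \<Rightarrow> real \<Rightarrow> real" where
  "log_kernel r w = 1 / ((- ln w) powr (1 + r) * w)"

lemma log_kernel_nonneg: "0 \<le> w \<Longrightarrow> 0 \<le> log_kernel r w"
  by (simp add: log_kernel_def)

lemma measurable_log_kernel [measurable]: "log_kernel r \<in> borel_measurable borel"
  unfolding log_kernel_def by measurable

text \<open>
  The substitution \<open>w = exp (- s)\<close> shows that this is the integral of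
  \<open>(1 - exp (- s)) / s powr (1 + r)\<close> over the positive half-line, that is,
  \<open>Gamma (1 - r) / r\<close> for \<open>0 < r < 1\<close>.
\<close>

definition moment_const :: "real \<Rightarrow> ennreal" where
  "moment_const r = (\<integral>\<^sup>+w\<in>{0<..<1}. ennreal ((1 - w) * log_kernel r w) \<partial>lborel)"

text \<open>
  This is the homogeneity of the kernel. The factor \<open>n * w ^ (n - 1)\<close> is the
  derivative of \<open>w ^ n\<close>, so that the left-hand side is what the change of variables produces.
\<close>

lemma log_kernel_power:
  assumes "0 < w" "w < 1" "0 < n"
  shows "log_kernel r (w ^ n) * (real n * w ^ (n - 1)) = real n powr - r * log_kernel r w"
proof -
  define L where "L = - ln w"
  have L: "0 < L" "- ln (w ^ n) = real n * L"
    using assms by (simp_all add: L_def ln_realpow)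
  have w: "w ^ n = w ^ (n - 1) * w"
    using assms by (simp flip: power_Suc2)
  have "log_kernel r (w ^ n) * (real n * w ^ (n - 1)) = real n / ((real n * L) powr (1 + r) * w)"
    unfolding log_kernel_def L(2) using assms by (simp add: w del: ln_realpow)
  also have "\<dots> = real n powr - r / (L powr (1 + r) * w)"
    using assms L(1) by (simp add: powr_mult powr_add powr_minus divide_simps)
  finally show ?thesis
    by (simp add: log_kernel_def L_def)
qed

text \<open>
  This change of variables produces the moment of order \<open>r\<close>. For \<open>n = 0\<close>, where \<open>w ^ n\<close> is no
  change of variables, both sides vanish because \<open>0 powr r = 0\<close>.
\<close>

lemma nn_integral_one_minus_power_log_kernel:
  "(\<integral>\<^sup>+w\<in>{0<..<1}. ennreal ((1 - w ^ n) * log_kernel r w) \<partial>lborel)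
     = ennreal (real n powr r) * moment_const r"
proof (cases "n = 0")
  case True
  then show ?thesis by simp
next
  case False
  \<comment> \<open>The indicator inside \<open>f\<close> removes the endpoints of the closed intervals that the
    substitution rule requires.\<close>
  define f where "f u = (1 - u) * log_kernel r u * indicator {0<..<1} u" for u :: real
  have [measurable]: "f \<in> borel_measurable borel"
    unfolding f_def by measurable
  have "moment_const r = (\<integral>\<^sup>+u. ennreal (f u * indicator {0 ^ n..1 ^ n} u) \<partial>lborel)"
    unfolding moment_const_def f_def using False
    by (intro nn_integral_cong) (auto simp: indicator_def power_0_left)
  also have "\<dots> = (\<integral>\<^sup>+w. ennreal (f (w ^ n) * (real n * w ^ (n - 1)) * indicator {0..1} w) \<partial>lborel)"
  proof (rule nn_integral_substitution)
    show "set_borel_measurable borel {0 ^ n..1 ^ n} f"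
      unfolding set_borel_measurable_def by measurable
    show "continuous_on {0..1} (\<lambda>w. real n * w ^ (n - 1))"
      by (intro continuous_intros)
  qed (auto intro!: derivative_eq_intros)
  also have "\<dots> = (\<integral>\<^sup>+w. ennreal (real n powr - r) *
      (ennreal ((1 - w ^ n) * log_kernel r w) * indicator {0<..<1} w) \<partial>lborel)"
  proof (intro nn_integral_cong)
    fix w :: real
    have "f (w ^ n) * (real n * w ^ (n - 1)) = real n powr - r * ((1 - w ^ n) * log_kernel r w)"
      if "0 < w" "w < 1"
      using that False log_kernel_power[of w n r]
      by (simp add: f_def power_less_one_iff algebra_simps)
    moreover have "f (w ^ n) = 0" if "w = 0 \<or> w = 1"
      using that False by (auto simp: f_def power_0_left)
    ultimately show "ennreal (f (w ^ n) * (real n * w ^ (n - 1)) * indicator {0..1} w) =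
        ennreal (real n powr - r) *
          (ennreal ((1 - w ^ n) * log_kernel r w) * indicator {0<..<1} w)"
      by (cases "0 < w \<and> w < 1") (auto simp: ennreal_mult' indicator_def)
  qed
  also have "\<dots> = ennreal (real n powr - r) *
      (\<integral>\<^sup>+w\<in>{0<..<1}. ennreal ((1 - w ^ n) * log_kernel r w) \<partial>lborel)"
    by (rule nn_integral_cmult) measurable
  finally have "ennreal (real n powr r) * moment_const r = ennreal (real n powr r * real n powr - r) *
      (\<integral>\<^sup>+w\<in>{0<..<1}. ennreal ((1 - w ^ n) * log_kernel r w) \<partial>lborel)"
    by (simp add: ennreal_mult' mult.assoc)
  then show ?thesis
    using False by (simp flip: powr_add)
qed

lemma moment_const_pos: "0 < moment_const r"
proof -
  have "\<not> (AE w in lborel. ennreal ((1 - w) * log_kernel r w) * indicator {0<..<1} w = 0)"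
  proof
    assume "AE w in lborel. ennreal ((1 - w) * log_kernel r w) * indicator {0<..<1} w = 0"
    moreover have "ennreal ((1 - w) * log_kernel r w) * indicator {0<..<1} w \<noteq> 0"
      if "w \<in> {0<..<1}" for w :: real
      using that by (auto simp: log_kernel_def ennreal_eq_0_iff not_le)
    ultimately have "AE w in lborel. w \<notin> {0<..<1::real}"
      by (auto elim!: eventually_mono)
    then have "emeasure lborel {0<..<1::real} = 0"
      by (subst (asm) AE_iff_measurable[where N = "{0<..<1}"]) auto
    then show False by simp
  qed
  then show ?thesis
    unfolding moment_const_def
    by (subst zero_less_iff_neq_zero, subst nn_integral_0_iff_AE) auto
qed

text \<open>
  By monotone convergence along compact subintervals, the integral is the difference of the limits
  of the antiderivative. Only the antiderivative has to stay bounded: \<open>f\<close> may blow up at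
  the endpoints, as it does in the applications below.
\<close>

lemma set_nn_integral_finite_of_antiderivative:
  fixes f F :: "real \<Rightarrow> real"
  assumes "a < b"
    and "\<And>w. a < w \<Longrightarrow> w < b \<Longrightarrow> (F has_real_derivative f w) (at w)"
    and "\<And>w. a < w \<Longrightarrow> w < b \<Longrightarrow> isCont f w"
    and "\<And>w. a < w \<Longrightarrow> w < b \<Longrightarrow> 0 \<le> f w"
    and "(F \<longlongrightarrow> A) (at_right a)" and "(F \<longlongrightarrow> B) (at_left b)"
  shows "(\<integral>\<^sup>+w\<in>{a<..<b}. ennreal (f w) \<partial>lborel) < \<infinity>"
proof -
  have "set_integrable lborel (einterval (ereal a) (ereal b)) f"
    by (rule interval_integral_FTC_nonneg(1)[where F = F and A = A and B = B])
      (use assms in \<open>auto simp: ereal_tendsto_simps1 ereal_tendsto_simps2\<close>)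
  then have "integrable lborel (\<lambda>w. indicator {a<..<b} w *\<^sub>R f w)"
    by (simp add: set_integrable_def einterval_eq_Icc)
  then have "(\<integral>\<^sup>+w. ennreal (norm (indicator {a<..<b} w *\<^sub>R f w)) \<partial>lborel) < \<infinity>"
    by (simp add: integrable_iff_bounded)
  also have "(\<integral>\<^sup>+w. ennreal (norm (indicator {a<..<b} w *\<^sub>R f w)) \<partial>lborel) =
      (\<integral>\<^sup>+w\<in>{a<..<b}. ennreal (f w) \<partial>lborel)"
    using assms(4) by (intro nn_integral_cong) (auto simp: indicator_def)
  finally show ?thesis .
qed

lemma log_kernel_eq_powr:
  "0 < w \<Longrightarrow> w < 1 \<Longrightarrow> log_kernel r w = (- ln w) powr (- r - 1) / w"
  unfolding log_kernel_def
  by (simp add: powr_minus[symmetric] divide_simps flip: powr_add)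

lemma moment_const_finite:
  assumes "0 < r" "r < 1"
  shows "moment_const r < \<infinity>"
proof -
  \<comment> \<open>The estimate \<open>1 - w \<le> 1\<close> is too weak near 1, and \<open>1 - w \<le> - ln w\<close> too weak near 0 (for
    \<open>w\<close> near 0 the resulting \<open>(- ln w) powr - r / w\<close> is not integrable), so the interval is cut at
    an arbitrary interior point.\<close>
  define a :: real where "a = 1 / 2"
  have a: "0 < a" "a < 1" by (simp_all add: a_def)
  have near_0: "(\<integral>\<^sup>+w\<in>{0<..<a}. ennreal (log_kernel r w) \<partial>lborel) < \<infinity>"
  proof (rule set_nn_integral_finite_of_antiderivative
      [where F = "\<lambda>w. (- ln w) powr - r / r" and A = 0 and B = "(- ln a) powr - r / r"])
    show "((\<lambda>w. (- ln w) powr - r / r) \<longlongrightarrow> 0) (at_right 0)"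
      using assms by real_asymp
    show "((\<lambda>w. (- ln w) powr - r / r) \<longlongrightarrow> (- ln a) powr - r / r) (at_left a)"
      using a assms by (auto intro!: tendsto_eq_intros)
    fix w assume w: "0 < w" "w < a"
    then have "w < 1" using a by simp
    then show "((\<lambda>w. (- ln w) powr - r / r) has_real_derivative log_kernel r w) (at w)"
      using w assms by (auto intro!: derivative_eq_intros simp: log_kernel_eq_powr field_simps)
    show "isCont (log_kernel r) w"
      unfolding log_kernel_def[abs_def] using w \<open>w < 1\<close> by (auto intro!: continuous_intros)
    show "0 \<le> log_kernel r w" using w by (simp add: log_kernel_nonneg)
  qed (use a in auto)
  have near_1: "(\<integral>\<^sup>+w\<in>{a<..<1}. ennreal ((- ln w) powr - r / w) \<partial>lborel) < \<infinity>"
  proof (rule set_nn_integral_finite_of_antiderivative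
      [where F = "\<lambda>w. - ((- ln w) powr (1 - r) / (1 - r))" and B = 0
        and A = "- ((- ln a) powr (1 - r) / (1 - r))"])
    show "((\<lambda>w. - ((- ln w) powr (1 - r) / (1 - r))) \<longlongrightarrow> 0) (at_left 1)"
      using assms by real_asymp
    show "((\<lambda>w. - ((- ln w) powr (1 - r) / (1 - r))) \<longlongrightarrow> - ((- ln a) powr (1 - r) / (1 - r))) (at_right a)"
      using a assms by (auto intro!: tendsto_eq_intros)
    fix w assume w: "a < w" "w < 1"
    then have "0 < w" using a by simp
    then show "((\<lambda>w. - ((- ln w) powr (1 - r) / (1 - r))) has_real_derivative (- ln w) powr - r / w) (at w)"
      using w assms by (auto intro!: derivative_eq_intros)
    show "isCont (\<lambda>w. (- ln w) powr - r / w) w"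
      using w \<open>0 < w\<close> by (auto intro!: continuous_intros)
    show "0 \<le> (- ln w) powr - r / w" using \<open>0 < w\<close> by simp
  qed (use a in auto)
  have bound: "(1 - w) * log_kernel r w \<le> (- ln w) powr - r / w" if "0 < w" "w < 1" for w
  proof -
    have "(1 - w) * log_kernel r w \<le> (- ln w) * log_kernel r w"
      using that ln_le_minus_one[of w] by (intro mult_right_mono log_kernel_nonneg) auto
    also have "\<dots> = (- ln w) powr - r / w"
      using that powr_add[of "- ln w" 1 "- r - 1"] by (simp add: log_kernel_eq_powr)
    finally show ?thesis .
  qed
  have "moment_const r \<le> (\<integral>\<^sup>+w. ennreal (log_kernel r w) * indicator {0<..<a} w +
      ennreal ((- ln w) powr - r / w) * indicator {a<..<1} w \<partial>lborel)"
    unfolding moment_const_def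
  proof (rule nn_integral_mono_AE)
    show "AE w in lborel. ennreal ((1 - w) * log_kernel r w) * indicator {0<..<1} w \<le>
        ennreal (log_kernel r w) * indicator {0<..<a} w +
        ennreal ((- ln w) powr - r / w) * indicator {a<..<1} w"
      using AE_lborel_singleton[of a]
    proof eventually_elim
      case (elim w)
      have "(1 - w) * log_kernel r w \<le> log_kernel r w" if "0 < w"
        using that log_kernel_nonneg[of w r] by (simp add: algebra_simps)
      with elim bound[of w] show ?case
        using a by (auto simp: indicator_def intro: ennreal_leI)
    qed
  qed
  also have "\<dots> = (\<integral>\<^sup>+w\<in>{0<..<a}. ennreal (log_kernel r w) \<partial>lborel) +
      (\<integral>\<^sup>+w\<in>{a<..<1}. ennreal ((- ln w) powr - r / w) \<partial>lborel)"
    by (rule nn_integral_add) measurable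
  also have "\<dots> < \<infinity>"
    using near_0 near_1 by simp
  finally show ?thesis .
qed

text \<open>
  The nonnegativity of \<open>1 - w ^ n\<close> for \<open>0 < w < 1\<close> allows the exchange of integrals
  for an arbitrary nonnegative kernel, whether or not either side is finite.
\<close>

lemma nn_integral_pgf_kernel:
  fixes k :: "real \<Rightarrow> real"
  assumes "prob_space M" and Z [measurable]: "Z \<in> measurable M (count_space UNIV)"
    and [measurable]: "k \<in> borel_measurable borel"
    and k: "\<And>w. 0 < w \<Longrightarrow> w < 1 \<Longrightarrow> 0 \<le> k w"
  shows "(\<integral>\<^sup>+w\<in>{0<..<1}. ennreal ((1 - pgf M Z w) * k w) \<partial>lborel) =
    (\<integral>\<^sup>+x. (\<integral>\<^sup>+w\<in>{0<..<1}. ennreal ((1 - w ^ Z x) * k w) \<partial>lborel) \<partial>M)"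
proof -
  interpret prob_space M by fact
  interpret pair_sigma_finite M lborel ..
  have slice: "ennreal ((1 - pgf M Z w) * k w) = (\<integral>\<^sup>+x. ennreal ((1 - w ^ Z x) * k w) \<partial>M)"
    if w: "0 < w" "w < 1" for w
  proof -
    have int: "integrable M (\<lambda>x. w ^ Z x)"
      using w by (intro integrable_const_bound[where B = 1]) (auto simp: power_le_one)
    have "(\<integral>\<^sup>+x. ennreal ((1 - w ^ Z x) * k w) \<partial>M) = ennreal (\<integral>x. (1 - w ^ Z x) * k w \<partial>M)"
      using w k[OF w] int by (intro nn_integral_eq_integral) (auto simp: power_le_one)
    also have "(\<integral>x. (1 - w ^ Z x) * k w \<partial>M) = (1 - pgf M Z w) * k w"
      using int by (simp add: pgf_def prob_space)
    finally show ?thesis ..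
  qed
  \<comment> \<open>The exponent is itself measurable, so the countably many fixed-exponent powers are glued.\<close>
  have "(\<lambda>p. snd p ^ n) \<in> borel_measurable (M \<Otimes>\<^sub>M (borel :: real measure))" for n
    by measurable
  then have [measurable]:
    "(\<lambda>p. snd p ^ Z (fst p) :: real) \<in> borel_measurable (M \<Otimes>\<^sub>M borel)"
    by (rule measurable_compose_countable[where f = "\<lambda>n p. snd p ^ n" and g = "\<lambda>p. Z (fst p)"])
      simp_all
  have "(\<integral>\<^sup>+w\<in>{0<..<1}. ennreal ((1 - pgf M Z w) * k w) \<partial>lborel) =
      (\<integral>\<^sup>+w. (\<integral>\<^sup>+x. ennreal ((1 - w ^ Z x) * k w) * indicator {0<..<1} w \<partial>M) \<partial>lborel)"
    by (intro nn_integral_cong) (auto simp: indicator_def slice)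
  also have "\<dots> = (\<integral>\<^sup>+x. (\<integral>\<^sup>+w\<in>{0<..<1}. ennreal ((1 - w ^ Z x) * k w) \<partial>lborel) \<partial>M)"
    by (rule Fubini') measurable
  finally show ?thesis .
qed

theorem theorem3:
  fixes M :: "'a measure" and Z :: "'a \<Rightarrow> nat" and r :: real
  assumes "prob_space M"
    and "Z \<in> measurable M (count_space UNIV)"
    and "0 < r" and "r < 1"
  shows "(\<integral>\<^sup>+x. ennreal (real (Z x) powr r) \<partial>M) < \<infinity> \<longleftrightarrow>
    (\<integral>\<^sup>+w\<in>{0<..<1::real}. ennreal ((1 - pgf M Z w) / ((- ln w) powr (1 + r) * w)) \<partial>lborel) < \<infinity>"
proof -
  note [measurable] = assms(2)
  have "(\<integral>\<^sup>+w\<in>{0<..<1::real}. ennreal ((1 - pgf M Z w) / ((- ln w) powr (1 + r) * w)) \<partial>lborel) =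
      (\<integral>\<^sup>+w\<in>{0<..<1}. ennreal ((1 - pgf M Z w) * log_kernel r w) \<partial>lborel)"
    by (simp add: log_kernel_def)
  also have "\<dots> = (\<integral>\<^sup>+x. ennreal (real (Z x) powr r) * moment_const r \<partial>M)"
    using assms
    by (simp add: nn_integral_pgf_kernel log_kernel_nonneg nn_integral_one_minus_power_log_kernel)
  also have "\<dots> = (\<integral>\<^sup>+x. ennreal (real (Z x) powr r) \<partial>M) * moment_const r"
    by (rule nn_integral_multc) measurable
  finally show ?thesis
    using moment_const_pos[of r] moment_const_finite[OF assms(3,4)]
    by (auto simp: ennreal_mult_less_top)
qed

end
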